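(* For every non-negative integer $k$ there exists a finite $k$-connected graph that is not a monoid graph.
   Context: All monoids and graphs are finite; graphs are simple and undirected. For a monoid $M$ and $C\subseteq M$, $\underline{\mathrm{Cay}}(M,C)$ is the simple undirected graph with vertex set $M$ in which distinct $x,y$ are adjacent if and only if $y=xc$ or $x=yc$ for some $c\in C$. A monoid graph is a simple undirected graph isomorphic to $\underline{\mathrm{Cay}}(M,C)$ for some monoid $M$ and some $C\subseteq M$. A subset $V'$ of vertices of a connected graph $G$ is a vertex cut if $G\setminus V'$ is not connected. A connected graph $G$ on $n$ vertices is $k$-connected if all its vertex cuts have size at least $k$ and $k+1\leq n$. *)

theory Defs
  imports "HOL-Algebra.Group" "Graph_Theory.Digraph_Component" "Graph_Theory.Digraph_Isomorphism"
begin

text \<open>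
  A finite simple undirected graph is a \<^locale>\<open>pair_graph\<close>: a finite, loop-free, symmetric set of
  pairs of vertices.
\<close>

definition Cay :: "('a, 'b) monoid_scheme \<Rightarrow> 'a set \<Rightarrow> 'a pair_pre_digraph" where
  "Cay M C = \<lparr> pverts = carrier M,
     parcs = {(x, y). x \<in> carrier M \<and> y \<in> carrier M \<and> x \<noteq> y \<and>
       (\<exists>c\<in>C. y = x \<otimes>\<^bsub>M\<^esub> c \<or> x = y \<otimes>\<^bsub>M\<^esub> c)} \<rparr>"

text \<open>
  One cannot quantify over the type of the elements of \<open>M\<close>. As \<open>M\<close> is finite, nothing is lost by
  taking them in \<^typ>\<open>nat\<close>; see \<open>monoid_graphI\<close> below.
\<close>

definition monoid_graph :: "'a pair_pre_digraph \<Rightarrow> bool" where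
  "monoid_graph G \<longleftrightarrow> pair_graph G \<and>
     (\<exists>(M :: nat monoid) C. Group.monoid M \<and> finite (carrier M) \<and> C \<subseteq> carrier M \<and>
        digraph_iso (with_proj G) (with_proj (Cay M C)))"

text \<open>
  The null graph is not \<^const>\<open>connected\<close>, so the full vertex set counts as a vertex cut. This does
  not affect \<open>k_connected\<close>, which requires more than \<open>k\<close> vertices.
\<close>

definition vertex_cut :: "'a pair_pre_digraph \<Rightarrow> 'a set \<Rightarrow> bool" where
  "vertex_cut G S \<longleftrightarrow> S \<subseteq> pverts G \<and> \<not> connected (with_proj G \<restriction> (pverts G - S))"

definition k_connected :: "nat \<Rightarrow> 'a pair_pre_digraph \<Rightarrow> bool" where
  "k_connected k G \<longleftrightarrow> connected (with_proj G) \<and>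
     (\<forall>S. vertex_cut G S \<longrightarrow> k \<le> card S) \<and> k + 1 \<le> card (pverts G)"

lemma pair_graph_Cay:
  assumes "finite (carrier M)"
  shows "pair_graph (Cay M C)"
proof -
  have "parcs (Cay M C) \<subseteq> carrier M \<times> carrier M"
    by (auto simp: Cay_def)
  then have "finite (parcs (Cay M C))"
    using assms by (meson finite_SigmaI finite_subset)
  moreover have "symmetric (with_proj (Cay M C))"
    by (auto simp: symmetric_def sym_def Cay_def)
  ultimately show ?thesis
    using assms by unfold_locales (auto simp: Cay_def)
qed

lemma digraph_iso_with_proj_iff:
  assumes G: "pair_wf_digraph G" and H: "pair_wf_digraph H"
  shows "digraph_iso (with_proj G) (with_proj H) \<longleftrightarrow>
    (\<exists>f. bij_betw f (pverts G) (pverts H) \<and>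
      (\<forall>x\<in>pverts G. \<forall>y\<in>pverts G. (x, y) \<in> parcs G \<longleftrightarrow> (f x, f y) \<in> parcs H))"
    (is "?L \<longleftrightarrow> ?R")
proof
  interpret G: pair_wf_digraph G by fact
  interpret H: pair_wf_digraph H by fact
  {
    assume ?L
    then obtain h where h: "pre_digraph.digraph_isomorphism (with_proj G) h"
      and HG: "with_proj H = app_iso h (with_proj G)"
      by (auto simp: digraph_iso_def)
    from HG have eqs: "pverts H = iso_verts h ` pverts G" "parcs H = iso_arcs h ` parcs G"
        "iso_tail h = fst" "iso_head h = snd"
      by (simp_all add: app_iso_def with_proj_def)
    from h have inj: "inj_on (iso_verts h) (pverts G)"
      and ends: "\<And>a. a \<in> parcs G \<Longrightarrow> iso_arcs h a = (iso_verts h (fst a), iso_verts h (snd a))"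
      unfolding pre_digraph.digraph_isomorphism_def by (auto simp: eqs prod_eq_iff)
    have "(x, y) \<in> parcs G \<longleftrightarrow> (iso_verts h x, iso_verts h y) \<in> parcs H"
      if xy: "x \<in> pverts G" "y \<in> pverts G" for x y
    proof
      assume "(x, y) \<in> parcs G"
      then show "(iso_verts h x, iso_verts h y) \<in> parcs H"
        using ends[of "(x, y)"] unfolding eqs by force
    next
      assume "(iso_verts h x, iso_verts h y) \<in> parcs H"
      then obtain u v where uv: "(u, v) \<in> parcs G"
        and *: "(iso_verts h x, iso_verts h y) = iso_arcs h (u, v)"
        unfolding eqs by auto
      from * ends[OF uv] have "iso_verts h x = iso_verts h u" "iso_verts h y = iso_verts h v"
        by auto
      then have "x = u" "y = v"
        using inj xy G.in_arcsD1[OF uv] G.in_arcsD2[OF uv] by (auto dest: inj_onD)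
      with uv show "(x, y) \<in> parcs G" by simp
    qed
    with inj show ?R
      by (intro exI[of _ "iso_verts h"]) (auto simp: bij_betw_def eqs)
  next
    assume ?R
    then obtain f where bij: "bij_betw f (pverts G) (pverts H)"
      and adj: "\<And>x y. x \<in> pverts G \<Longrightarrow> y \<in> pverts G \<Longrightarrow>
        (x, y) \<in> parcs G \<longleftrightarrow> (f x, f y) \<in> parcs H"
      by blast
    from bij have inj: "inj_on f (pverts G)" and im: "pverts H = f ` pverts G"
      by (auto simp: bij_betw_def)
    define h where "h = \<lparr> iso_verts = f, iso_arcs = map_prod f f, iso_head = snd, iso_tail = fst \<rparr>"
    have "inj_on (map_prod f f) (parcs G)"
      using map_prod_inj_on[OF inj inj]
      by (rule inj_on_subset) (auto dest: G.in_arcsD1 G.in_arcsD2)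
    then have "pre_digraph.digraph_isomorphism (with_proj G) h"
      using inj G.wf_digraph_axioms
      by (auto simp: pre_digraph.digraph_isomorphism_def h_def wf_digraph_wp_iff G)
    moreover have "parcs H = map_prod f f ` parcs G"
    proof (intro Set.set_eqI iffI)
      fix e assume e: "e \<in> parcs H"
      obtain a b where ab: "e = (a, b)" by (cases e)
      with e have "a \<in> f ` pverts G" "b \<in> f ` pverts G"
        using H.in_arcsD1[of a b] H.in_arcsD2[of a b] im by auto
      then obtain x y where "x \<in> pverts G" "y \<in> pverts G" "a = f x" "b = f y"
        by auto
      with adj[of x y] e ab show "e \<in> map_prod f f ` parcs G" by force
    next
      fix e assume "e \<in> map_prod f f ` parcs G"
      then obtain x y where "(x, y) \<in> parcs G" "e = (f x, f y)" by auto
      with adj[of x y] show "e \<in> parcs H"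
        using G.in_arcsD1[of x y] G.in_arcsD2[of x y] by auto
    qed
    then have "with_proj H = app_iso h (with_proj G)"
      by (simp add: app_iso_def with_proj_def h_def im)
    ultimately show ?L by (auto simp: digraph_iso_def)
  }
qed

lemma monoid_graphI:
  fixes M :: "('b, 'c) monoid_scheme"
  assumes G: "pair_graph G" and M: "Group.monoid M" and fin: "finite (carrier M)"
    and C: "C \<subseteq> carrier M" and iso: "digraph_iso (with_proj G) (with_proj (Cay M C))"
  shows "monoid_graph G"
proof -
  interpret M: Group.monoid M by fact
  obtain f :: "'b \<Rightarrow> nat" where inj: "inj_on f (carrier M)"
    using finite_imp_inj_to_nat_seg[OF fin] by blast
  define g where "g = the_inv_into (carrier M) f"
  have gf: "g (f x) = x" if "x \<in> carrier M" for x
    using the_inv_into_f_f[OF inj that] by (simp add: g_def)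
  define N :: "nat monoid" where
    "N = \<lparr> carrier = f ` carrier M, monoid.mult = (\<lambda>a b. f (g a \<otimes>\<^bsub>M\<^esub> g b)), monoid.one = f \<one>\<^bsub>M\<^esub> \<rparr>"
  have N: "Group.monoid N"
    by unfold_locales (auto simp: N_def gf M.m_assoc)
  have finN: "finite (carrier N)" and CN: "f ` C \<subseteq> carrier N"
    using fin C by (auto simp: N_def)
  have arc: "(f x, f y) \<in> parcs (Cay N (f ` C)) \<longleftrightarrow> (x, y) \<in> parcs (Cay M C)"
    if xy: "x \<in> carrier M" "y \<in> carrier M" for x y
  proof -
    have eq: "f u = f v \<longleftrightarrow> u = v" if "u \<in> carrier M" "v \<in> carrier M" for u v
      using inj that by (auto dest: inj_onD)
    have "f y = f x \<otimes>\<^bsub>N\<^esub> f c \<longleftrightarrow> y = x \<otimes>\<^bsub>M\<^esub> c" "f x = f y \<otimes>\<^bsub>N\<^esub> f c \<longleftrightarrow> x = y \<otimes>\<^bsub>M\<^esub> c"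
      if "c \<in> C" for c
      using that C xy by (auto simp: N_def gf eq subsetD)
    then show ?thesis
      using xy eq[OF xy] by (simp add: Cay_def N_def)
  qed
  interpret G: pair_graph G by fact
  interpret CM: pair_graph "Cay M C" by (rule pair_graph_Cay[OF fin])
  interpret CN: pair_graph "Cay N (f ` C)" by (rule pair_graph_Cay[OF finN])
  have "digraph_iso (with_proj (Cay M C)) (with_proj (Cay N (f ` C)))"
    unfolding digraph_iso_with_proj_iff[OF CM.pair_wf_digraph CN.pair_wf_digraph]
    using inj arc by (intro exI[of _ f]) (auto simp: bij_betw_def Cay_def N_def)
  then have "digraph_iso (with_proj G) (with_proj (Cay N (f ` C)))"
    using iso digraph_iso_trans by blast
  then show ?thesis
    unfolding monoid_graph_def using G N finN CN by blast
qed

end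

theory Submission
  imports Defs
begin

text \<open>
  Join a large clique \<open>D\<close> to a copy \<open>P\<close> of \<open>K\<^sub>m\<^sub>,\<^sub>m\<close> by a matching. Suppose that this graph
  is \<open>Cay M C\<close>. Each vertex is the source of at most \<open>|C - {\<one>}|\<close> edges, so the edges
  inside \<open>D\<close> force \<open>\<one>\<close> to have degree at least \<open>(|D| - 1) / 2\<close>, which puts \<open>\<one>\<close> into \<open>D\<close>.
  Hence all elements of \<open>C\<close> but at most one lie in \<open>D\<close>. For \<open>x\<close> in \<open>P\<close>, left multiplication by \<open>x\<close> turns
  edges into edges or collapses them, so \<open>x D\<close> is a clique through \<open>x\<close> and has at most two vertices.
  Thus at most two edges leave \<open>x\<close>, while \<open>K\<^sub>m\<^sub>,\<^sub>m\<close> has too many edges for that if \<open>m\<close> is large.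
\<close>

section \<open>Cayley graphs on the vertex set itself\<close>

text \<open>Conjugating the multiplication by the isomorphism \<open>f\<close> moves the monoid onto
  the vertices, so that \<open>G\<close> equals a Cayley graph and its vertices can be multiplied
  directly.\<close>

lemma monoid_graphE:
  fixes G :: "'a pair_pre_digraph"
  assumes "monoid_graph G"
  obtains M :: "'a monoid" and C where "Group.monoid M" "carrier M = pverts G" "C \<subseteq> pverts G" "Cay M C = G"
proof -
  from assms obtain N :: "nat monoid" and B where G: "pair_graph G" and N: "Group.monoid N"
    and fin: "finite (carrier N)" and B: "B \<subseteq> carrier N"
    and iso: "digraph_iso (with_proj G) (with_proj (Cay N B))"
    unfolding monoid_graph_def by blast
  interpret G: pair_graph G by fact
  interpret CN: pair_graph "Cay N B" by (rule pair_graph_Cay[OF fin])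
  interpret N: Group.monoid N by fact
  obtain f where f: "bij_betw f (pverts G) (pverts (Cay N B))"
    and arc: "\<And>x y. x \<in> pverts G \<Longrightarrow> y \<in> pverts G \<Longrightarrow> (x, y) \<in> parcs G \<longleftrightarrow> (f x, f y) \<in> parcs (Cay N B)"
    using iso unfolding digraph_iso_with_proj_iff[OF G.pair_wf_digraph CN.pair_wf_digraph] by blast
  from f have f: "bij_betw f (pverts G) (carrier N)" by (simp add: Cay_def)
  define g where "g = the_inv_into (pverts G) f"
  have g: "bij_betw g (carrier N) (pverts G)"
    unfolding g_def by (rule bij_betw_the_inv_into[OF f])
  have gf: "g (f x) = x" if "x \<in> pverts G" for x
    using f that by (simp add: g_def bij_betw_def the_inv_into_f_f)
  have fg: "f (g a) = a" if "a \<in> carrier N" for a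
    using f that by (simp add: g_def f_the_inv_into_f_bij_betw)
  have fN: "f x \<in> carrier N" if "x \<in> pverts G" for x
    using f that by (auto simp: bij_betw_def)
  have gG: "g a \<in> pverts G" if "a \<in> carrier N" for a
    using g that by (auto simp: bij_betw_def)
  define M :: "'a monoid" where
    "M = \<lparr> carrier = pverts G, monoid.mult = (\<lambda>x y. g (f x \<otimes>\<^bsub>N\<^esub> f y)), monoid.one = g \<one>\<^bsub>N\<^esub> \<rparr>"
  have "Group.monoid M"
    by unfold_locales (auto simp: M_def gf fg fN gG N.m_assoc)
  moreover have "carrier M = pverts G" by (simp add: M_def)
  moreover have "g ` B \<subseteq> pverts G" using B gG by auto
  moreover have "Cay M (g ` B) = G"
  proof -
    have eq: "y = x \<otimes>\<^bsub>M\<^esub> g b \<longleftrightarrow> f y = f x \<otimes>\<^bsub>N\<^esub> b"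
      if "x \<in> pverts G" "y \<in> pverts G" "b \<in> B" for x y b
    proof -
      have b: "b \<in> carrier N" using that B by auto
      then have "f x \<otimes>\<^bsub>N\<^esub> b \<in> carrier N" using fN[OF that(1)] by simp
      then show ?thesis
        using that b fg[of b] gf[of y] fg[of "f x \<otimes>\<^bsub>N\<^esub> b"] by (auto simp: M_def)
    qed
    have "(x, y) \<in> parcs (Cay M (g ` B)) \<longleftrightarrow> (x, y) \<in> parcs G" for x y
    proof (cases "x \<in> pverts G \<and> y \<in> pverts G")
      case True
      moreover from this have "f x = f y \<longleftrightarrow> x = y" using gf by metis
      ultimately show ?thesis
        using arc[of x y] eq[of x y] eq[of y x] fN[of x] fN[of y] by (auto simp: Cay_def M_def)
    next
      case False
      then show ?thesis
        using G.in_arcsD1[of x y] G.in_arcsD2[of x y] by (auto simp: Cay_def M_def)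
    qed
    then have "parcs (Cay M (g ` B)) = parcs G" by auto
    then show ?thesis by (simp add: Cay_def M_def)
  qed
  ultimately show thesis by (rule that)
qed

text \<open>Every arc inside \<open>W\<close> or its reverse has the form (x, x c) with x in
  \<open>W\<close>. The set \<open>R\<close> of these pairs has at most r members for each x, whence
  the factor 2.\<close>

lemma card_Cay_arcs_le:
  assumes W: "finite W" and C: "finite C"
    and r: "\<And>x. x \<in> W \<Longrightarrow> card ((\<lambda>c. x \<otimes>\<^bsub>M\<^esub> c) ` C - {x}) \<le> r"
  shows "card (parcs (Cay M C) \<inter> W \<times> W) \<le> 2 * r * card W"
proof -
  define R where "R = Sigma W (\<lambda>x. (\<lambda>c. x \<otimes>\<^bsub>M\<^esub> c) ` C - {x})"
  have finR: "finite R" using W C by (simp add: R_def)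
  have "card R = (\<Sum>x\<in>W. card ((\<lambda>c. x \<otimes>\<^bsub>M\<^esub> c) ` C - {x}))"
    unfolding R_def using W C by (intro card_SigmaI) auto
  also have "\<dots> \<le> card W * r" using sum_bounded_above[of W _ r] r by simp
  finally have "card R \<le> card W * r" .
  moreover have "parcs (Cay M C) \<inter> W \<times> W \<subseteq> R \<union> R\<inverse>"
    by (auto simp: Cay_def R_def)
  then have "card (parcs (Cay M C) \<inter> W \<times> W) \<le> card R + card (R\<inverse>)"
    using finR by (meson card_Un_le card_mono finite_Un finite_converse le_trans)
  then have "card (parcs (Cay M C) \<inter> W \<times> W) \<le> 2 * card R" by (simp add: card_inverse)
  ultimately show ?thesis by (simp add: mult.commute mult.left_commute)
qed

text \<open>Associativity turns b = a c into x b = (x a) c. Left multiplication in a monoid may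
  identify a and b, so the images are assumed distinct.\<close>

lemma Cay_mult_left:
  assumes "Group.monoid M" "C \<subseteq> carrier M" "x \<in> carrier M" "(a, b) \<in> parcs (Cay M C)"
    and "x \<otimes>\<^bsub>M\<^esub> a \<noteq> x \<otimes>\<^bsub>M\<^esub> b"
  shows "(x \<otimes>\<^bsub>M\<^esub> a, x \<otimes>\<^bsub>M\<^esub> b) \<in> parcs (Cay M C)"
proof -
  interpret Group.monoid M by fact
  show ?thesis using assms(2-5) by (auto simp: Cay_def subset_iff m_assoc)
qed

section \<open>A counting obstruction\<close>

text \<open>The constants come from \<open>card_Cay_arcs_le\<close>: the factor 2 in
  \<open>degree\<close>, and 4 = 2 * 2 in \<open>many\<close> because each x in \<open>P\<close> has
  at most two products x c other than x.\<close>

lemma not_monoid_graphI: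
  fixes G :: "'a pair_pre_digraph"
  assumes verts: "pverts G = D \<union> P" and disj: "D \<inter> P = {}"
    and clique: "\<And>x y. x \<in> D \<Longrightarrow> y \<in> D \<Longrightarrow> x \<noteq> y \<Longrightarrow> (x, y) \<in> parcs G"
    and degree: "\<And>x. x \<in> P \<Longrightarrow> 2 * card {y. (x, y) \<in> parcs G} + 1 < card D"
    and matching: "\<And>d x y. d \<in> D \<Longrightarrow> x \<in> P \<Longrightarrow> y \<in> P \<Longrightarrow> (d, x) \<in> parcs G \<Longrightarrow> (d, y) \<in> parcs G \<Longrightarrow> x = y"
    and triangle: "\<And>x a b. x \<in> P \<Longrightarrow> (x, a) \<in> parcs G \<Longrightarrow> (x, b) \<in> parcs G \<Longrightarrow> (a, b) \<notin> parcs G"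
    and many: "4 * card P < card (parcs G \<inter> P \<times> P)"
  shows "\<not> monoid_graph G"
proof
  assume mg: "monoid_graph G"
  then interpret pair_graph G by (simp add: monoid_graph_def)
  from mg obtain M :: "'a monoid" and C where M: "Group.monoid M" and carr: "carrier M = pverts G"
    and C: "C \<subseteq> pverts G" and G: "Cay M C = G"
    by (rule monoid_graphE)
  interpret M: Group.monoid M by fact
  have fin: "finite D" "finite P" "finite C"
    using pair_finite_verts C by (auto simp: verts intro: finite_subset)
  have one: "\<one>\<^bsub>M\<^esub> \<in> D \<union> P" using carr verts M.one_closed by simp
  have adj1: "(\<one>\<^bsub>M\<^esub>, c) \<in> parcs G" if "c \<in> C" "c \<noteq> \<one>\<^bsub>M\<^esub>" for c
    using that C M.one_closed unfolding G[symmetric] by (auto simp: Cay_def carr[symmetric] subset_iff intro!: bexI[of _ c])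
  have "\<one>\<^bsub>M\<^esub> \<notin> P"
  proof
    assume P: "\<one>\<^bsub>M\<^esub> \<in> P"
    define r where "r = card {y. (\<one>\<^bsub>M\<^esub>, y) \<in> parcs G}"
    have "finite {y. (\<one>\<^bsub>M\<^esub>, y) \<in> parcs G}"
      using pair_finite_verts by (rule finite_subset[rotated]) (auto dest: in_arcsD2)
    then have Cr: "card (C - {\<one>\<^bsub>M\<^esub>}) \<le> r"
      unfolding r_def by (rule card_mono) (auto intro: adj1)
    have "card ((\<lambda>c. x \<otimes>\<^bsub>M\<^esub> c) ` C - {x}) \<le> r" if "x \<in> D" for x
    proof -
      \<comment> \<open>The product with \<one> is x itself, which is removed.\<close>
      have "(\<lambda>c. x \<otimes>\<^bsub>M\<^esub> c) ` C - {x} \<subseteq> (\<lambda>c. x \<otimes>\<^bsub>M\<^esub> c) ` (C - {\<one>\<^bsub>M\<^esub>})"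
        using that by (auto simp: carr verts)
      then have "card ((\<lambda>c. x \<otimes>\<^bsub>M\<^esub> c) ` C - {x}) \<le> card (C - {\<one>\<^bsub>M\<^esub>})"
        using fin by (meson card_image_le card_mono finite_Diff finite_imageI le_trans)
      with Cr show ?thesis by simp
    qed
    then have "card (parcs G \<inter> D \<times> D) \<le> 2 * r * card D"
      using card_Cay_arcs_le[OF fin(1,3)] G by metis
    moreover have "parcs G \<inter> D \<times> D = D \<times> D - Id_on D"
      using clique no_loops' by auto
    moreover have "card (D \<times> D - Id_on D) = card D * card D - card D"
    proof -
      have "Id_on D = (\<lambda>x. (x, x)) ` D" by auto
      moreover have "card ((\<lambda>x. (x, x)) ` D) = card D"
        by (rule card_image) (auto simp: inj_on_def)
      ultimately show ?thesis
        using fin(1) by (subst card_Diff_subset) (auto simp: card_cartesian_product)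
    qed
    \<comment> \<open>Cancelling |D| yields the bound that contradicts \<open>degree\<close> at
      \<one>.\<close>
    ultimately have "card D * card D \<le> (2 * r + 1) * card D" by simp
    then have "card D = 0 \<or> card D \<le> 2 * r + 1" unfolding mult_le_cancel2 by auto
    then show False using degree[OF P] by (simp add: r_def)
  qed
  with one have oneD: "\<one>\<^bsub>M\<^esub> \<in> D" by simp
  have out: "card ((\<lambda>c. x \<otimes>\<^bsub>M\<^esub> c) ` C - {x}) \<le> 2" if x: "x \<in> P" for x
  proof -
    have xM: "x \<in> carrier M" using x by (simp add: carr verts)
    have C': "C \<subseteq> carrier M" using C by (simp only: carr)
    \<comment> \<open>\<open>E\<close> omits x, so x = x \<one> with \<one> in \<open>D\<close>
      makes every member of \<open>E\<close> a neighbour of x. Two distinct members would form a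
      triangle with x. \<open>F\<close> takes care of the rest of \<open>C\<close>.\<close>
    define E where "E = (\<lambda>c. x \<otimes>\<^bsub>M\<^esub> c) ` (C \<inter> D) - {x}"
    define F where "F = (\<lambda>c. x \<otimes>\<^bsub>M\<^esub> c) ` (C \<inter> P)"
    have move: "(x \<otimes>\<^bsub>M\<^esub> a, x \<otimes>\<^bsub>M\<^esub> b) \<in> parcs G"
      if "a \<in> D" "b \<in> D" "x \<otimes>\<^bsub>M\<^esub> a \<noteq> x \<otimes>\<^bsub>M\<^esub> b" for a b
    proof -
      have "(a, b) \<in> parcs (Cay M C)" using that by (auto simp: G intro: clique)
      from M C' xM this that(3) have "(x \<otimes>\<^bsub>M\<^esub> a, x \<otimes>\<^bsub>M\<^esub> b) \<in> parcs (Cay M C)"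
        by (rule Cay_mult_left)
      then show ?thesis by (simp only: G)
    qed
    have "u = v" if uv: "u \<in> E" "v \<in> E" for u v
    proof (rule ccontr)
      assume "u \<noteq> v"
      with uv obtain a b where ab: "a \<in> D" "b \<in> D" "u = x \<otimes>\<^bsub>M\<^esub> a" "v = x \<otimes>\<^bsub>M\<^esub> b"
        by (auto simp: E_def)
      have "(x, u) \<in> parcs G" "(x, v) \<in> parcs G" "(u, v) \<in> parcs G"
        using move[OF oneD ab(1)] move[OF oneD ab(2)] move[OF ab(1,2)] uv \<open>u \<noteq> v\<close> ab xM
        by (auto simp: E_def)
      with triangle[OF x] show False by blast
    qed
    then have "\<forall>u\<in>E. \<forall>v\<in>E. u = v" by blast
    moreover have "finite E" using fin by (simp add: E_def)
    ultimately have "card E \<le> 1" by (simp only: One_nat_def card_le_Suc0_iff_eq)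
    \<comment> \<open>Elements of \<open>C \<inter> P\<close> are neighbours of \<one>, which is in
      \<open>D\<close>.\<close>
    moreover have "\<forall>u\<in>C \<inter> P. \<forall>v\<in>C \<inter> P. u = v"
      using adj1 matching[OF oneD] \<open>\<one>\<^bsub>M\<^esub> \<notin> P\<close> by blast
    then have "card (C \<inter> P) \<le> 1"
      unfolding One_nat_def by (subst card_le_Suc0_iff_eq) (use fin in auto)
    then have "card F \<le> 1"
      unfolding F_def using fin(3) by (meson card_image_le finite_Int le_trans)
    moreover have "card ((\<lambda>c. x \<otimes>\<^bsub>M\<^esub> c) ` C - {x}) \<le> card (E \<union> F)"
      using C fin by (intro card_mono) (auto simp: E_def F_def verts)
    moreover have "card (E \<union> F) \<le> card E + card F" by (rule card_Un_le)
    ultimately show ?thesis by simp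
  qed
  then have "card (parcs G \<inter> P \<times> P) \<le> 4 * card P"
    using card_Cay_arcs_le[OF fin(2,3), of M 2] by (simp add: G)
  with many show False by simp
qed

section \<open>High connectivity\<close>

text \<open>Paths to the hub can be reversed by symmetry, so any two vertices are joined through h.
  The symmetric closure inside \<open>connected\<close> adds no arcs here.\<close>

lemma connected_induceI:
  assumes G: "pair_sym_digraph G" and h: "h \<in> V"
    and hub: "\<And>v. v \<in> V \<Longrightarrow> (v, h) \<in> (parcs G \<inter> V \<times> V)\<^sup>*"
  shows "connected (with_proj G \<restriction> V)"
proof -
  interpret G: pair_sym_digraph G by fact
  define R where "R = parcs G \<inter> V \<times> V"
  have "sym R" unfolding R_def by (auto intro!: symI dest: G.arcs_symmetric)
  then have symR: "sym (R\<^sup>*)" by (rule sym_rtrancl)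
  have eq: "pverts (mk_symmetric (with_proj G \<restriction> V)) = V" "parcs (mk_symmetric (with_proj G \<restriction> V)) = R"
    by (auto simp: parcs_mk_symmetric R_def dest: G.arcs_symmetric)
  interpret H: pair_wf_digraph "mk_symmetric (with_proj G \<restriction> V)"
    by unfold_locales (auto simp: eq R_def)
  show ?thesis
    unfolding connected_def
  proof (rule strongly_connectedI)
    show "verts (with_proj (mk_symmetric (with_proj G \<restriction> V))) \<noteq> {}"
      using h by auto
  next
    fix u v
    assume "u \<in> verts (with_proj (mk_symmetric (with_proj G \<restriction> V)))"
      and "v \<in> verts (with_proj (mk_symmetric (with_proj G \<restriction> V)))"
    then have uv: "u \<in> V" "v \<in> V" by auto
    then have "(u, h) \<in> R\<^sup>*" "(h, v) \<in> R\<^sup>*"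
      using hub symR by (auto simp: R_def dest: symD)
    then have "(u, v) \<in> R\<^sup>*" by (rule rtrancl_trans)
    then show "u \<rightarrow>\<^sup>*\<^bsub>with_proj (mk_symmetric (with_proj G \<restriction> V))\<^esub> v"
      using uv by (simp add: H.reachable_conv eq)
  qed
qed

text \<open>
  The clique is \<open>{..<n}\<close>; parity gives the two sides of \<open>K\<^sub>m\<^sub>,\<^sub>m\<close> on the remaining vertices.
\<close>

definition clique_bip :: "nat \<Rightarrow> nat \<Rightarrow> nat pair_pre_digraph" where
  "clique_bip n m = \<lparr> pverts = {..<n + 2 * m},
     parcs = {(x, y). x < n + 2 * m \<and> y < n + 2 * m \<and> x \<noteq> y \<and>
       (x < n \<and> y < n \<or> n \<le> x \<and> n \<le> y \<and> odd (x + y) \<or> y = x + n \<or> x = y + n)} \<rparr>"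

lemma pair_graph_clique_bip: "pair_graph (clique_bip n m)"
proof -
  have "parcs (clique_bip n m) \<subseteq> {..<n + 2 * m} \<times> {..<n + 2 * m}"
    by (auto simp: clique_bip_def)
  then have "finite (parcs (clique_bip n m))"
    by (rule finite_subset) simp
  moreover have "symmetric (with_proj (clique_bip n m))"
    by (auto simp: symmetric_def sym_def clique_bip_def)
  ultimately show ?thesis
    by unfold_locales (auto simp: clique_bip_def)
qed

text \<open>The m matched pairs i, n + i are disjoint, so \<open>S\<close> misses one of them
  entirely. Its clique end i serves as the hub, reached from the bipartite part through n +
  i.\<close>

lemma connected_clique_bip_Diff:
  assumes n: "2 * m \<le> n" and S: "finite S" "card S < m"
  shows "connected (with_proj (clique_bip n m) \<restriction> (pverts (clique_bip n m) - S))"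
proof -
  interpret G: pair_graph "clique_bip n m" by (rule pair_graph_clique_bip)
  have avoid: "\<exists>j<m. f j \<notin> S" if "inj_on f {..<m}" for f :: "nat \<Rightarrow> nat"
  proof (rule ccontr)
    assume "\<not> ?thesis"
    then have "f ` {..<m} \<subseteq> S" by auto
    then have "card {..<m} \<le> card S" using that S(1) by (metis card_image card_mono)
    with S(2) show False by simp
  qed
  \<comment> \<open>The value lies in \<open>S\<close> as soon as i or n + i does, so a value
    outside \<open>S\<close> certifies an intact pair. Injectivity holds because i < m \<le>
    n.\<close>
  have "inj_on (\<lambda>i. if i \<in> S then i else n + i) {..<m}"
    using n by (auto simp: inj_on_def)
  from avoid[OF this] obtain i where i: "i < m" "i \<notin> S" "n + i \<notin> S"
    by (auto split: if_splits)
  define V where "V = pverts (clique_bip n m) - S"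
  define R where "R = parcs (clique_bip n m) \<inter> V \<times> V"
  have pi: "(n + i, i) \<in> R"
    using i n by (auto simp: R_def V_def clique_bip_def)
  have "(v, i) \<in> R\<^sup>*" if v: "v \<in> V" for v
  proof (cases "v < n")
    case True
    then have "v = i \<or> (v, i) \<in> R"
      using v i n by (auto simp: R_def V_def clique_bip_def)
    then show ?thesis by auto
  next
    case False
    show ?thesis
    proof (cases "odd (v + (n + i))")
      case True
      then have "(v, n + i) \<in> R"
        using v i False by (auto simp: R_def V_def clique_bip_def)
      with pi show ?thesis by (meson rtrancl.simps)
    next
      case even: False
      \<comment> \<open>Here v and n + i are on the same side. The offset \<open>t\<close> selects
        the other side, whose m vertices cannot all be in \<open>S\<close>; a surviving w gives the
        walk v, w, n + i, i.\<close>
      define t :: nat where "t = (if even (v + n) then 1 else 0)"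
      have "inj_on (\<lambda>j. n + 2 * j + t) {..<m}" by (auto simp: inj_on_def)
      from avoid[OF this] obtain j where j: "j < m" "n + 2 * j + t \<notin> S" by auto
      define w where "w = n + 2 * j + t"
      have w: "odd (v + w)" "odd (w + (n + i))" "n \<le> w" "w < n + 2 * m" "w \<notin> S"
        using even j by (auto simp: w_def t_def split: if_splits)
      have "(v, w) \<in> R" "(w, n + i) \<in> R"
        using v i False w by (auto simp: R_def V_def clique_bip_def)
      with pi show ?thesis by (meson rtrancl.simps)
    qed
  qed
  moreover have "i \<in> V" using i by (auto simp: V_def clique_bip_def)
  ultimately show ?thesis
    unfolding V_def[symmetric] using connected_induceI[OF G.pair_sym_digraph_axioms] by (simp add: R_def)
qed

lemma k_connected_clique_bip:
  assumes "2 * m \<le> n" "k < m"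
  shows "k_connected k (clique_bip n m)"
proof -
  have fin: "finite (pverts (clique_bip n m))" by (simp add: clique_bip_def)
  have "with_proj (clique_bip n m) \<restriction> pverts (clique_bip n m) = with_proj (clique_bip n m)"
    by (auto simp: induce_subgraph_def with_proj_def clique_bip_def)
  then have "connected (with_proj (clique_bip n m))"
    using connected_clique_bip_Diff[OF assms(1), of "{}"] assms(2) by simp
  moreover have "k \<le> card S" if "vertex_cut (clique_bip n m) S" for S
  proof (rule ccontr)
    assume "\<not> k \<le> card S"
    moreover have "finite S" using that fin by (auto simp: vertex_cut_def intro: finite_subset)
    ultimately show False
      using that connected_clique_bip_Diff[OF assms(1), of S] assms(2) by (simp add: vertex_cut_def)
  qed
  ultimately show ?thesis using assms by (simp add: k_connected_def clique_bip_def)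
qed

section \<open>The obstruction applies\<close>

text \<open>A crude bound of 2 * m + 1 on the degrees in the bipartite part requires n > 2 * (2 * m
  + 1) + 1. The condition 8 < m makes m * m exceed 4 * (2 * m).\<close>

lemma not_monoid_graph_clique_bip:
  assumes n: "4 * m + 3 < n" and m: "8 < m"
  shows "\<not> monoid_graph (clique_bip n m)"
proof (rule not_monoid_graphI[where D = "{..<n}" and P = "{n..<n + 2 * m}"])
  fix x assume x: "x \<in> {n..<n + 2 * m}"
  have "{y. (x, y) \<in> parcs (clique_bip n m)} \<subseteq> insert (x - n) {n..<n + 2 * m}"
    using x by (auto simp: clique_bip_def)
  then have "card {y. (x, y) \<in> parcs (clique_bip n m)} \<le> card (insert (x - n) {n..<n + 2 * m})"
    by (intro card_mono) auto
  also have "\<dots> \<le> 2 * m + 1" by (simp add: card_insert_if)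
  finally show "2 * card {y. (x, y) \<in> parcs (clique_bip n m)} + 1 < card {..<n}"
    using n by simp
next
  \<comment> \<open>Arcs in one direction between the two sides already suffice.\<close>
  have "(\<lambda>(i, j). (n + 2 * i, n + 2 * j + 1)) ` ({..<m} \<times> {..<m})
      \<subseteq> parcs (clique_bip n m) \<inter> {n..<n + 2 * m} \<times> {n..<n + 2 * m}"
    by (auto simp: clique_bip_def) presburger+
  moreover have "inj_on (\<lambda>(i, j). (n + 2 * i, n + 2 * j + 1)) ({..<m} \<times> {..<m})"
    by (auto simp: inj_on_def)
  ultimately have "card ({..<m} \<times> {..<m}) \<le> card (parcs (clique_bip n m) \<inter> {n..<n + 2 * m} \<times> {n..<n + 2 * m})"
    by (intro card_inj_on_le) auto
  moreover have "8 * m < m * m" using m by simp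
  ultimately have "8 * m < card (parcs (clique_bip n m) \<inter> {n..<n + 2 * m} \<times> {n..<n + 2 * m})"
    unfolding card_cartesian_product card_lessThan by linarith
  then show "4 * card {n..<n + 2 * m} < card (parcs (clique_bip n m) \<inter> {n..<n + 2 * m} \<times> {n..<n + 2 * m})"
    by simp
next
  fix x a b
  assume "x \<in> {n..<n + 2 * m}" and arcs: "(x, a) \<in> parcs (clique_bip n m)" "(x, b) \<in> parcs (clique_bip n m)"
  then have x: "n \<le> x" "x < n + 2 * m" by auto
  \<comment> \<open>As x + n is not a vertex, a neighbour of x is its clique partner or has the
    opposite parity.\<close>
  have "x \<noteq> y \<and> (x = y + n \<or> n \<le> y \<and> odd (x + y))" if "(x, y) \<in> parcs (clique_bip n m)" for y
  proof -
    from that have "y < n + 2 * m" "x \<noteq> y"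
      and "x < n \<and> y < n \<or> n \<le> x \<and> n \<le> y \<and> odd (x + y) \<or> y = x + n \<or> x = y + n"
      unfolding clique_bip_def by simp_all
    moreover from this(1) have "\<not> x < n" "y \<noteq> x + n" using x n by linarith+
    ultimately show ?thesis by blast
  qed
  from this[OF arcs(1)] this[OF arcs(2)]
  have xa: "x = a + n \<or> n \<le> a \<and> odd (x + a)" and xb: "x = b + n \<or> n \<le> b \<and> odd (x + b)"
    and "x \<noteq> a" "x \<noteq> b" by blast+
  show "(a, b) \<notin> parcs (clique_bip n m)"
  proof
    assume "(a, b) \<in> parcs (clique_bip n m)"
    then have ab: "a \<noteq> b" "a < n + 2 * m" "b < n + 2 * m"
      and arc: "a < n \<and> b < n \<or> n \<le> a \<and> n \<le> b \<and> odd (a + b) \<or> b = a + n \<or> a = b + n"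
      unfolding clique_bip_def by simp_all
    \<comment> \<open>The partner of x is unique and has no other neighbour than x in the bipartite
      part, while two neighbours on the opposite side have equal parity.\<close>
    consider "x = a + n" "x = b + n" | "x = a + n" "n \<le> b" | "n \<le> a" "x = b + n"
      | "n \<le> a" "n \<le> b" "odd (x + a)" "odd (x + b)"
      using xa xb by blast
    then show False
    proof cases
      case 1 with ab show False by simp
    next
      case 2
      then have "b = x" using x ab arc n by auto
      with \<open>x \<noteq> b\<close> show False by simp
    next
      case 3
      then have "a = x" using x ab arc n by auto
      with \<open>x \<noteq> a\<close> show False by simp
    next
      case 4
      then have e: "even (a + b)" by simp
      have "b \<noteq> a + n" "a \<noteq> b + n" using 4 ab n by auto
      with 4 e arc show False by auto
    qed
  qed
next
  show "pverts (clique_bip n m) = {..<n} \<union> {n..<n + 2 * m}"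
    by (auto simp: clique_bip_def)
next
  fix x y assume "x \<in> {..<n}" "y \<in> {..<n}" "x \<noteq> y"
  then show "(x, y) \<in> parcs (clique_bip n m)"
    by (simp add: clique_bip_def)
next
  fix d x y
  assume "d \<in> {..<n}" "x \<in> {n..<n + 2 * m}" "y \<in> {n..<n + 2 * m}"
    "(d, x) \<in> parcs (clique_bip n m)" "(d, y) \<in> parcs (clique_bip n m)"
  then have "x = d + n" "y = d + n" by (auto simp: clique_bip_def)
  then show "x = y" by simp
qed auto

theorem theorem4p12:
  shows "\<forall>k :: nat. \<exists>G :: nat pair_pre_digraph. pair_graph G \<and> k_connected k G \<and> \<not> monoid_graph G"
proof
  fix k :: nat
  \<comment> \<open>With m = k + 9, both k < m and 8 < m hold, and 4 * k + 40 is the least n above 4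
    * m + 3.\<close>
  have "k_connected k (clique_bip (4 * k + 40) (k + 9))"
    by (rule k_connected_clique_bip) auto
  moreover have "\<not> monoid_graph (clique_bip (4 * k + 40) (k + 9))"
    by (rule not_monoid_graph_clique_bip) auto
  ultimately show "\<exists>G :: nat pair_pre_digraph. pair_graph G \<and> k_connected k G \<and> \<not> monoid_graph G"
    using pair_graph_clique_bip by blast
qed

end
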